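(* Let $k\geq 2$ be an integer and define $C_{k,j}$, $0\le j\le k-1$, by \[ \frac{(2x)\,\big(x-\tfrac{k-1}{2}+1\big)\big(x-\tfrac{k-1}{2}+2\big)\cdots\big(x-\tfrac{k-1}{2}+k-2\big)}{(k-1)!}=P_k\!\left(x-\frac{k-1}{2}\right)=\frac{1}{(k-1)!}\sum_{j=0}^{k-1} C_{k,j}\,x^j, \] where $P_k(x)=\frac{(2x+k-1)(x+1)\cdots(x+k-2)}{(k-1)!}$. Then $C_{k,j}=B_{k,j}$ for all $0\le j\le k-1$.
   Context: The Stirling numbers of the first kind $s_{n,m}$ ($n\ge 1$, $0\le m\le n$) are defined by $x(x+1)\cdots(x+n-1)=\sum_{m=0}^{n}(-1)^{n+m}s_{n,m}x^m$. For integers $k\ge 2$ and $0\le j\le k-1$, \[ B_{k,j}=\sum_{p=0}^{k-j-1}(-1)^{k+j+1}\binom{j+p}{j}\left(\frac{k-1}{2}\right)^p\left(s_{k,j+p+1}+s_{k-1,j+p}\right). \] For $k=2$ the product $(x+1)\cdots(x+k-2)$ in $P_k$ is empty and equals $1$. *)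

theory Defs
  imports
    Complex_Main
    "HOL-Computational_Algebra.Polynomial"
    "HOL-Combinatorics.Stirling"
begin

text \<open>
  These are the signed Stirling numbers of the first kind, read off as coefficients of the
  rising factorial; the library's \<open>stirling\<close> is the unsigned version.
\<close>

definition stirling1 :: "nat \<Rightarrow> nat \<Rightarrow> int" where
  "stirling1 n m = (-1) ^ (n + m) * coeff (pochhammer [:0, 1:] n) m"

lemma stirling1_eq_stirling: "stirling1 n m = (-1) ^ (n + m) * int (stirling n m)"
proof -
  have "pochhammer [:0, 1::int:] n = (\<Sum>i\<le>n. monom (int (stirling n i)) i)"
    by (simp add: stirling_pochhammer [symmetric] of_nat_poly monom_altdef)
  then show ?thesis
    by (cases "m \<le> n") (auto simp: stirling1_def coeff_sum)
qed

lemma rising_factorial_stirling1: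
  fixes x :: "'a :: comm_ring_1"
  shows "(\<Prod>i<n. x + of_nat i) = (\<Sum>m=0..n. (-1) ^ (n + m) * of_int (stirling1 n m) * x ^ m)"
proof -
  have "(\<Prod>i<n. x + of_nat i) = pochhammer x n"
    by (simp add: pochhammer_prod atLeast0LessThan)
  then show ?thesis
    by (simp add: stirling1_eq_stirling stirling_pochhammer [symmetric] atLeast0AtMost
        mult.assoc [symmetric] power_add [symmetric] mult_2 [symmetric])
qed

definition P_poly :: "nat \<Rightarrow> real poly" where
  "P_poly k = smult (1 / fact (k - 1))
     ([:real k - 1, 2:] * (\<Prod>i = 1..k - 2. [:real i, 1:]))"

lemma poly_P_poly:
  "poly (P_poly k) x = (2 * x + real k - 1) * (\<Prod>i = 1..k - 2. x + real i) / fact (k - 1)"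
  by (simp add: P_poly_def poly_prod field_simps)

text \<open>
  The coefficients of \<open>(k - 1)!\<close> times the shifted polynomial.
\<close>

definition C_coeff :: "nat \<Rightarrow> nat \<Rightarrow> real" where
  "C_coeff k j = fact (k - 1) * coeff (pcompose (P_poly k) [:- ((real k - 1) / 2), 1:]) j"

definition B_coeff :: "nat \<Rightarrow> nat \<Rightarrow> real" where
  "B_coeff k j = (\<Sum>p = 0..k - j - 1.
     (-1) ^ (k + j + 1) * real ((j + p) choose j) * ((real k - 1) / 2) ^ p
       * real_of_int (stirling1 k (j + p + 1) + stirling1 (k - 1) (j + p)))"

end

theory Submission
  imports Defs
begin

text \<open>
  With \<open>q(x) = (2x + k - 1)(x + 1)\<cdots>(x + k - 2)\<close>, the numerator of \<open>P\<^sub>k\<close>, the factorisation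
  \<open>2x + k - 1 = (x + k - 1) + x\<close> turns \<open>x q(x)\<close> into the rising factorial of length \<open>k\<close>
  plus \<open>x\<close> times the one of length \<open>k - 1\<close>. This gives the coefficients of \<open>q\<close> as sums of two
  unsigned Stirling numbers, and the shift \<open>x \<mapsto> x - (k - 1)/2\<close> is expanded by the binomial
  theorem; the signs in \<open>B\<^sub>k\<^sub>,\<^sub>j\<close> reduce to \<open>(-1)\<^sup>p\<close>.
\<close>

text \<open>Expand \<open>p\<close> into monomials and apply the binomial theorem to each power of
  \<open>[:a, 1:]\<close>. The bound \<open>n\<close> need not be the exact degree, so the sum can
  have the fixed range used in \<open>B_coeff\<close>.\<close>

lemma coeff_pcompose_linear:
  fixes p :: "'a :: comm_semiring_1 poly"
  assumes "degree p \<le> n" "j \<le> n"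
  shows "coeff (pcompose p [:a, 1:]) j
           = (\<Sum>i = 0..n - j. of_nat ((j + i) choose j) * a ^ i * coeff p (j + i))"
proof -
  have power_coeff: "coeff ([:a, 1:] ^ m) j = (if m < j then 0 else of_nat (m choose j) * a ^ (m - j))" for m
    by (auto simp: coeff_linear_poly_power degree_linear_power intro!: coeff_eq_0)
  have monom_pcompose: "pcompose (monom c m) [:a, 1:] = smult c ([:a, 1:] ^ m)" for c :: 'a and m
    by (induction m) (simp_all add: monom_0 monom_Suc pcompose_pCons)
  have "coeff (pcompose p [:a, 1:]) j
      = coeff (pcompose (\<Sum>m\<le>n. monom (coeff p m) m) [:a, 1:]) j"
    by (simp only: poly_as_sum_of_monoms'[OF assms(1)])
  also have "\<dots> = (\<Sum>m\<le>n. coeff p m * (if m < j then 0 else of_nat (m choose j) * a ^ (m - j)))"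
    by (simp add: pcompose_sum monom_pcompose coeff_sum power_coeff)
  also have "\<dots> = (\<Sum>m = j..n. coeff p m * (of_nat (m choose j) * a ^ (m - j)))"
    by (rule sum.mono_neutral_cong_right) auto
  also have "\<dots> = (\<Sum>i = 0..n - j. coeff p (j + i) * (of_nat ((j + i) choose j) * a ^ i))"
    by (rule sum.reindex_bij_witness[of _ "\<lambda>i. j + i" "\<lambda>m. m - j"]) (use assms in auto)
  finally show ?thesis
    by (simp add: mult_ac)
qed

lemma coeff_pochhammer_X:
  "coeff (pochhammer [:0, 1 :: 'a :: comm_semiring_1:] n) m = of_nat (stirling n m)"
proof -
  have "pochhammer [:0, 1 :: 'a:] n = (\<Sum>i\<le>n. monom (of_nat (stirling n i)) i)"
    by (simp add: stirling_pochhammer [symmetric] of_nat_poly monom_altdef)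
  then show ?thesis
    by (cases "m \<le> n") (auto simp: coeff_sum)
qed

lemma pochhammer_X_Suc:
  "pochhammer [:0, 1 :: 'a :: comm_semiring_1:] (Suc n) = [:0, 1:] * (\<Prod>i = 1..n. [:of_nat i, 1:])"
  by (simp add: pochhammer_prod atLeastLessThanSuc_atLeastAtMost prod.atLeast_Suc_atMost of_nat_poly)

lemma coeff_P_poly:
  assumes "k \<ge> 2"
  shows "fact (k - 1) * coeff (P_poly k) m = real (stirling k (m + 1)) + real (stirling (k - 1) m)"
proof -
  obtain n where k: "k = Suc (Suc n)"
    using assms by (metis add_2_eq_Suc le_Suc_ex)
  define R :: "real poly" where "R = (\<Prod>i = 1..n. [:real i, 1:])"
  have poch: "pochhammer [:0, 1 :: real:] (Suc n) = [:0, 1:] * R"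
    by (simp only: pochhammer_X_Suc R_def)
  \<comment> \<open>Multiplying by the indeterminate supplies the factor 0 of the rising factorial
    and shifts coefficients by one; hence they are compared at \<open>Suc m\<close> below.\<close>
  have "pCons 0 (smult (fact (k - 1)) (P_poly k)) = [:0, 1:] * ([:real k - 1, 2:] * R)"
    by (simp add: P_poly_def k R_def)
  \<comment> \<open>The bracketed summand is the last factor of the rising factorial of length
    \<open>k\<close>.\<close>
  also have "[:real k - 1, 2:] = [:0, 1:] + ([:0, 1:] + of_nat (Suc n))"
    by (simp add: k of_nat_poly del: of_nat_Suc)
  also have "[:0, 1:] * (([:0, 1:] + ([:0, 1:] + of_nat (Suc n))) * R)
      = pochhammer [:0, 1:] k + [:0, 1:] * pochhammer [:0, 1:] (k - 1)"
    by (simp only: k pochhammer_Suc[of _ "Suc n"] diff_Suc_1 poch) (simp only: algebra_simps)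
  finally have "coeff (pCons 0 (smult (fact (k - 1)) (P_poly k))) (Suc m)
      = coeff (pochhammer [:0, 1:] k + pCons 0 (pochhammer [:0, 1:] (k - 1))) (Suc m)"
    by simp
  then show ?thesis
    by (simp only: coeff_pCons_Suc coeff_add coeff_smult coeff_pochhammer_X Suc_eq_plus1 [symmetric])
qed

text \<open>Beyond index \<open>k - 1\<close> both Stirling numbers in \<open>coeff_P_poly\<close>
  vanish, their second argument exceeding the first.\<close>

lemma degree_P_poly_le:
  assumes "k \<ge> 2"
  shows "degree (P_poly k) \<le> k - 1"
proof (rule degree_le, intro allI impI)
  fix m assume "k - 1 < m"
  then have "fact (k - 1) * coeff (P_poly k) m = (0 :: real)"
    unfolding coeff_P_poly[OF assms] by simp
  then show "coeff (P_poly k) m = 0" by simp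
qed

lemma C_coeff_eq_B_coeff:
  assumes "k \<ge> 2" "j \<le> k - 1"
  shows "C_coeff k j = B_coeff k j"
proof -
  define a where "a = (real k - 1) / 2"
  have sign: "(- a) ^ p * (real (stirling k (j + p + 1)) + real (stirling (k - 1) (j + p)))
      = (-1) ^ (k + j + 1) * a ^ p
        * real_of_int (stirling1 k (j + p + 1) + stirling1 (k - 1) (j + p))" for p
  proof -
    \<comment> \<open>The exponents differ by 2, so both signed Stirling numbers carry the same
      sign, which factors out.\<close>
    have "(-1 :: real) ^ (k - 1 + (j + p)) = (-1) ^ (k + (j + p + 1))"
      using assms by (cases k) simp_all
    then have "real_of_int (stirling1 k (j + p + 1) + stirling1 (k - 1) (j + p))
        = (-1) ^ (k + (j + p + 1)) * (real (stirling k (j + p + 1)) + real (stirling (k - 1) (j + p)))"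
      by (simp add: stirling1_eq_stirling distrib_left del: stirling.simps)
    \<comment> \<open>The exponents add up to \<open>2 * (k + j + 1) + p\<close>.\<close>
    moreover have "(-1 :: real) ^ (k + j + 1) * (-1) ^ (k + (j + p + 1)) = (-1) ^ p"
      by (simp add: power_add mult_ac flip: power_mult_distrib)
    ultimately show ?thesis
      by (simp add: power_minus[of a] mult_ac)
  qed
  have "C_coeff k j = (\<Sum>p = 0..k - 1 - j.
      of_nat ((j + p) choose j) * (- a) ^ p * (fact (k - 1) * coeff (P_poly k) (j + p)))"
    unfolding C_coeff_def a_def [symmetric]
      coeff_pcompose_linear[OF degree_P_poly_le[OF assms(1)] assms(2)]
    by (simp add: sum_distrib_left mult_ac)
  also have "\<dots> = B_coeff k j"
    unfolding B_coeff_def a_def [symmetric] coeff_P_poly[OF assms(1)]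
    by (rule sum.cong, simp) (simp only: mult.assoc sign, simp only: mult_ac)
  finally show ?thesis .
qed

text \<open>This links \<open>C_coeff\<close>, defined through coefficients, to the expansion in
  powers of \<open>x\<close>; the degree bound justifies stopping at \<open>k - 1\<close>.\<close>

lemma poly_P_poly_shift:
  assumes "k \<ge> 2"
  shows "poly (P_poly k) (x - (real k - 1) / 2) = 1 / fact (k - 1) * (\<Sum>j = 0..k - 1. C_coeff k j * x ^ j)"
proof -
  define q where "q = pcompose (P_poly k) [:- ((real k - 1) / 2), 1:]"
  have "degree q \<le> k - 1"
    using degree_P_poly_le[OF assms] by (simp add: q_def degree_pcompose)
  then have "poly q x = (\<Sum>j = 0..k - 1. coeff q j * x ^ j)"
    unfolding poly_altdef atLeast0AtMost
    by (intro sum.mono_neutral_left) (auto simp: coeff_eq_0)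
  then show ?thesis
    by (simp add: C_coeff_def q_def poly_pcompose sum_distrib_left mult.assoc)
qed

theorem theorem4:
  fixes k :: nat
  assumes "k \<ge> 2"
  shows
    "(\<forall>x :: real.
        (2 * x) * (\<Prod>i = 1..k - 2. x - (real k - 1) / 2 + real i) / fact (k - 1)
          = poly (P_poly k) (x - (real k - 1) / 2)
      \<and> poly (P_poly k) (x - (real k - 1) / 2)
          = 1 / fact (k - 1) * (\<Sum>j = 0..k - 1. C_coeff k j * x ^ j))
     \<and> (\<forall>j \<le> k - 1. C_coeff k j = B_coeff k j)"
proof (intro conjI allI impI)
  fix x :: real
  \<comment> \<open>The shift moves the root of the linear factor of \<open>P_poly k\<close> to
    0.\<close>
  have "2 * x = 2 * (x - (real k - 1) / 2) + real k - 1"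
    by (simp add: field_simps)
  then show "(2 * x) * (\<Prod>i = 1..k - 2. x - (real k - 1) / 2 + real i) / fact (k - 1)
      = poly (P_poly k) (x - (real k - 1) / 2)"
    by (simp only: poly_P_poly)
qed (use poly_P_poly_shift[OF assms] C_coeff_eq_B_coeff[OF assms] in blast)+

end
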